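(* Let $H$ be a finitely generated monoid. Every divisor-closed submonoid $S$ of $H$ can be expressed as a union of Archimedean components of $H$. Furthermore, there exists an Archimedean component $\hat S$ of $H$ such that $$S=\bigcup \{S' \mid S' \text{ is an Archimedean component of } H \text{ and } S'\leq \hat S\}.$$
   Context: All monoids are commutative and cancellative and are written additively with identity $0$; a submonoid contains $0$. $\mathbb{N}$ denotes the nonnegative integers. For $a,b\in H$, write $b\leq_H a$ (``$b$ divides $a$'') if $a=b+c$ for some $c\in H$. A submonoid $S$ of $H$ is divisor-closed if $a\in S$, $b\in H$ and $b\leq_H a$ imply $b\in S$. Define the congruence $\mathcal N$ on $H$ by: $a\,\mathcal N\, b$ if there exist $k,l\in\mathbb{N}\setminus\{0\}$ such that $b\leq_H ka$ and $a\leq_H lb$. The elements of $H/\mathcal N$ (the equivalence classes, viewed as subsets of $H$) are the Archimedean components of $H$. They are ordered by: $S_1\leq S_2$ if and only if $a+b\in S_2$ for every $a\in S_1$ and every $b\in S_2$. *)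

theory Defs
  imports "HOL-Algebra.Divisibility" "HOL.Hull"
begin

text \<open>
  Commutative cancellative monoids are instances of the locale \<^locale>\<open>comm_monoid_cancel\<close>, whose
  notation is multiplicative: the sum \<open>a + b\<close>, the identity \<open>0\<close>, the multiple \<open>k a\<close> and the relation
  ``\<open>b\<close> divides \<open>a\<close>'' of the additive notation are \<open>a \<otimes> b\<close>, \<open>\<one>\<close>, \<open>a [^] k\<close> and \<open>b divides a\<close>.
\<close>

definition fin_gen_monoid :: "('a, 'b) monoid_scheme \<Rightarrow> bool" where
  "fin_gen_monoid H \<longleftrightarrow>
    (\<exists>A. finite A \<and> A \<subseteq> carrier H \<and> (\<lambda>T. submonoid T H) hull A = carrier H)"

definition divisor_closed_submonoid :: "'a set \<Rightarrow> ('a, 'b) monoid_scheme \<Rightarrow> bool" where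
  "divisor_closed_submonoid S H \<longleftrightarrow>
    submonoid S H \<and> (\<forall>a\<in>S. \<forall>b\<in>carrier H. b divides\<^bsub>H\<^esub> a \<longrightarrow> b \<in> S)"

definition arch_rel :: "('a, 'b) monoid_scheme \<Rightarrow> ('a \<times> 'a) set" where
  "arch_rel H = {(a, b). a \<in> carrier H \<and> b \<in> carrier H \<and>
    (\<exists>(k::nat) (l::nat). k \<noteq> 0 \<and> l \<noteq> 0 \<and>
      b divides\<^bsub>H\<^esub> (a [^]\<^bsub>H\<^esub> k) \<and> a divides\<^bsub>H\<^esub> (b [^]\<^bsub>H\<^esub> l))}"

definition arch_components :: "('a, 'b) monoid_scheme \<Rightarrow> 'a set set" where
  "arch_components H = carrier H // arch_rel H"

definition arch_le :: "('a, 'b) monoid_scheme \<Rightarrow> 'a set \<Rightarrow> 'a set \<Rightarrow> bool" where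
  "arch_le H S1 S2 \<longleftrightarrow> (\<forall>a\<in>S1. \<forall>b\<in>S2. a \<otimes>\<^bsub>H\<^esub> b \<in> S2)"

end

theory Submission
  imports Defs
begin

text \<open>
  Saturation: an element Archimedean equivalent to a member \<open>a\<close> of a divisor-closed submonoid
  \<open>S\<close> divides a multiple of \<open>a\<close>, hence lies in \<open>S\<close>; thus \<open>S\<close> is a union of components.

  The component \<open>S_hat\<close>: adding up the finitely many generators that lie in \<open>S\<close> gives some \<open>c \<in> S\<close>
  that each of them divides. Every element of \<open>S\<close> is a sum of generators, which are in \<open>S\<close> because
  they divide a member of \<open>S\<close>; so every element of \<open>S\<close> divides a multiple of \<open>c\<close>
  (\<open>divisor_closed_has_dominating_element\<close>). Conversely, any divisor of a multiple of \<open>c\<close> is in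
  \<open>S\<close>. Therefore the component of \<open>c\<close> serves as \<open>S_hat\<close>: the components below it are exactly those
  contained in \<open>S\<close> (\<open>arch_le_component_iff\<close>).
\<close>

lemma (in comm_monoid) divides_nat_pow_mono:
  assumes "a \<in> carrier G" "b \<in> carrier G" "a divides b"
  shows "(a [^] (n::nat)) divides (b [^] n)"
proof -
  from assms(3) obtain c where c: "c \<in> carrier G" "b = a \<otimes> c"
    by (auto elim: dividesE)
  then have "b [^] n = a [^] n \<otimes> c [^] n"
    using assms by (simp add: pow_mult_distrib m_comm)
  then show ?thesis using c by (auto intro: dividesI)
qed

lemma (in comm_monoid) divides_nat_pow_trans:
  assumes "a \<in> carrier G" "b \<in> carrier G" "c \<in> carrier G"
    and "a divides (b [^] (k::nat))" "b divides (c [^] (l::nat))"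
  shows "a divides (c [^] (l * k))"
proof -
  have "(b [^] k) divides ((c [^] l) [^] k)"
    using assms by (intro divides_nat_pow_mono) auto
  then show ?thesis
    using assms by (metis divides_trans nat_pow_pow)
qed

lemma (in comm_monoid) divides_mult_right:
  assumes "a \<in> carrier G" "b \<in> carrier G" "c \<in> carrier G" "a divides b"
  shows "a divides (b \<otimes> c)" "a divides (c \<otimes> b)"
proof -
  show *: "a divides (b \<otimes> c)"
    using assms by (blast intro: divides_trans dividesI)
  show "a divides (c \<otimes> b)"
    using * assms by (simp add: m_comm)
qed

lemma (in comm_monoid) equiv_arch_rel: "equiv (carrier G) (arch_rel G)"
proof (rule equivI)
  show "arch_rel G \<subseteq> carrier G \<times> carrier G"
    by (auto simp: arch_rel_def)
  show "refl_on (carrier G) (arch_rel G)"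
  proof (rule refl_onI)
    fix x assume "x \<in> carrier G"
    then have "x divides (x [^] (1::nat))" by simp
    then show "(x, x) \<in> arch_rel G"
      using \<open>x \<in> carrier G\<close> unfolding arch_rel_def by blast
  qed
  show "sym (arch_rel G)"
    by (rule symI) (auto simp: arch_rel_def)
  show "trans (arch_rel G)"
  proof (rule transI)
    fix x y z assume "(x, y) \<in> arch_rel G" "(y, z) \<in> arch_rel G"
    then obtain k l m n :: nat where
      x: "x \<in> carrier G" and y: "y \<in> carrier G" and z: "z \<in> carrier G"
      and nz: "k \<noteq> 0" "l \<noteq> 0" "m \<noteq> 0" "n \<noteq> 0"
      and "y divides (x [^] k)" "x divides (y [^] l)" "z divides (y [^] m)" "y divides (z [^] n)"
      unfolding arch_rel_def by blast
    then have "z divides (x [^] (k * m))" "x divides (z [^] (n * l))"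
      by (blast intro: divides_nat_pow_trans)+
    moreover have "k * m \<noteq> 0" "n * l \<noteq> 0" using nz by auto
    ultimately show "(x, z) \<in> arch_rel G"
      using x z unfolding arch_rel_def by blast
  qed
qed

lemma (in comm_monoid) Union_arch_components: "\<Union>(arch_components G) = carrier G"
  unfolding arch_components_def by (rule Union_quotient[OF equiv_arch_rel])

lemma (in monoid) submonoid_nat_pow_closed:
  assumes "submonoid S G" "a \<in> S"
  shows "a [^] (n::nat) \<in> S"
  using assms by (induction n) (auto intro: submonoid.one_closed submonoid.m_closed)

lemma (in comm_monoid) divisor_closed_arch_rel:
  assumes "divisor_closed_submonoid S G" "a \<in> S" "(a, b) \<in> arch_rel G"
  shows "b \<in> S"
  using assms submonoid_nat_pow_closed
  unfolding divisor_closed_submonoid_def arch_rel_def by blast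

lemma (in comm_monoid) divisor_closed_component_subset:
  assumes "divisor_closed_submonoid S G" "C \<in> arch_components G" "a \<in> C" "a \<in> S"
  shows "C \<subseteq> S"
proof
  fix b assume "b \<in> C"
  then have "(a, b) \<in> arch_rel G"
    using assms quotient_eq_iff[OF equiv_arch_rel, of C C a b]
    by (auto simp: arch_components_def)
  then show "b \<in> S"
    using assms divisor_closed_arch_rel by blast
qed

lemma (in comm_monoid) divisor_closed_mult_iff:
  assumes "divisor_closed_submonoid S G" "a \<in> carrier G" "b \<in> carrier G"
  shows "a \<otimes> b \<in> S \<longleftrightarrow> a \<in> S \<and> b \<in> S"
proof -
  have "a divides (a \<otimes> b)" "b divides (a \<otimes> b)"
    using assms by (auto intro: divides_mult_right)
  then show ?thesis
    using assms unfolding divisor_closed_submonoid_def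
    by (blast intro: submonoid.m_closed)
qed

lemma (in comm_monoid) finite_subset_has_common_multiple:
  assumes "submonoid S G" "finite F" "F \<subseteq> S"
  shows "\<exists>c\<in>S. \<forall>x\<in>F. x divides c"
  using assms(2,3)
proof (induction F)
  case empty
  then show ?case using submonoid.one_closed[OF assms(1)] by blast
next
  case (insert x F)
  then obtain c where c: "c \<in> S" "\<forall>y\<in>F. y divides c" by auto
  have sub: "S \<subseteq> carrier G" using assms(1) by (rule submonoid.subset)
  have "x \<otimes> c \<in> S"
    using insert.prems c submonoid.m_closed[OF assms(1)] by auto
  moreover have "\<forall>y\<in>insert x F. y divides (x \<otimes> c)"
    using insert.prems c sub
    by (metis divides_mult_right divides_refl insert_iff insert_subset subsetD)
  ultimately show ?case by blast
qed

lemma (in comm_monoid) divisor_closed_has_dominating_element: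
  assumes "fin_gen_monoid G" and S: "divisor_closed_submonoid S G"
  shows "\<exists>c\<in>S. \<forall>s\<in>S. \<exists>k::nat. k \<noteq> 0 \<and> s divides (c [^] k)"
proof -
  have sub: "submonoid S G" and S_carrier: "S \<subseteq> carrier G"
    using S submonoid.subset by (auto simp: divisor_closed_submonoid_def)
  obtain A where A: "finite A" "A \<subseteq> carrier G" "(\<lambda>T. submonoid T G) hull A = carrier G"
    using assms(1) by (auto simp: fin_gen_monoid_def)
  obtain c where c: "c \<in> S" "\<forall>x\<in>A \<inter> S. x divides c"
    using finite_subset_has_common_multiple[OF sub, of "A \<inter> S"] A(1) by auto
  have c_carrier: "c \<in> carrier G" using c(1) S_carrier by auto
  \<comment> \<open>The implication makes the condition vacuous outside \<open>S\<close>, so that it defines a submonoid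
    containing all generators.\<close>
  define T where
    "T = {x \<in> carrier G. x \<in> S \<longrightarrow> (\<exists>k::nat. k \<noteq> 0 \<and> x divides (c [^] k))}"
  have "submonoid T G"
  proof
    show "T \<subseteq> carrier G" by (auto simp: T_def)
    have "\<one> divides (c [^] (1::nat))" using c_carrier by (intro dividesI[of c]) auto
    then show "\<one> \<in> T" unfolding T_def by (blast intro: one_neq_zero)
    fix x y assume xy: "x \<in> T" "y \<in> T"
    then have carr: "x \<in> carrier G" "y \<in> carrier G" by (auto simp: T_def)
    have "\<exists>k::nat. k \<noteq> 0 \<and> (x \<otimes> y) divides (c [^] k)" if "x \<otimes> y \<in> S"
    proof -
      from that have "x \<in> S" "y \<in> S"
        using divisor_closed_mult_iff[OF S carr] by auto
      then obtain k l :: nat where kl: "k \<noteq> 0" "x divides (c [^] k)" "y divides (c [^] l)"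
        using xy by (auto simp: T_def)
      then have "(x \<otimes> y) divides (c [^] k \<otimes> y)" "(c [^] k \<otimes> y) divides (c [^] k \<otimes> c [^] l)"
        using carr c_carrier by (auto intro: divides_mult_rI divides_mult_lI)
      then have "(x \<otimes> y) divides (c [^] (k + l))"
        using carr c_carrier by (metis divides_trans m_closed nat_pow_mult)
      then show ?thesis using kl(1) by (metis add_is_0)
    qed
    then show "x \<otimes> y \<in> T" using carr by (auto simp: T_def)
  qed
  moreover have "A \<subseteq> T"
  proof
    fix x assume "x \<in> A"
    then have "x \<in> S \<Longrightarrow> x divides (c [^] (1::nat))" using c c_carrier by simp
    then show "x \<in> T" using \<open>x \<in> A\<close> A(2) unfolding T_def by (blast intro: one_neq_zero)
  qed
  ultimately have "carrier G \<subseteq> T"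
    using A(3) hull_minimal[of A T "\<lambda>T. submonoid T G"] by simp
  then show ?thesis using c(1) S_carrier by (auto simp: T_def)
qed

lemma (in comm_monoid) arch_le_component_iff:
  assumes S: "divisor_closed_submonoid S G"
    and c: "c \<in> S" "\<forall>s\<in>S. \<exists>k::nat. k \<noteq> 0 \<and> s divides (c [^] k)"
    and C: "C \<in> arch_components G"
  shows "arch_le G C (arch_rel G `` {c}) \<longleftrightarrow> C \<subseteq> S"
proof
  have S_carrier: "S \<subseteq> carrier G"
    using S submonoid.subset by (auto simp: divisor_closed_submonoid_def)
  have C_carrier: "C \<subseteq> carrier G"
    using C Union_arch_components by auto
  have c_carrier: "c \<in> carrier G" using c(1) S_carrier by auto
  have c_self: "(c, c) \<in> arch_rel G"
    using equiv_arch_rel c_carrier by (meson equivE refl_onD)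
  show "C \<subseteq> S" if le: "arch_le G C (arch_rel G `` {c})"
  proof
    fix a assume "a \<in> C"
    then have "(c, a \<otimes> c) \<in> arch_rel G"
      using le c_self by (auto simp: arch_le_def)
    then have "a \<otimes> c \<in> S" by (rule divisor_closed_arch_rel[OF S c(1)])
    then show "a \<in> S"
      using divisor_closed_mult_iff[OF S] \<open>a \<in> C\<close> C_carrier c_carrier by blast
  qed
  show "arch_le G C (arch_rel G `` {c})" if sub: "C \<subseteq> S"
    unfolding arch_le_def
  proof (intro ballI)
    fix a b assume a: "a \<in> C" and "b \<in> arch_rel G `` {c}"
    then have cb: "(c, b) \<in> arch_rel G" by simp
    then obtain l :: nat where b: "b \<in> carrier G" and l: "l \<noteq> 0" "c divides (b [^] l)"
      by (auto simp: arch_rel_def)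
    have a_carrier: "a \<in> carrier G" using a C_carrier by auto
    have "a \<otimes> b \<in> S"
      using divisor_closed_mult_iff[OF S a_carrier b] a sub divisor_closed_arch_rel[OF S c(1) cb]
      by auto
    then obtain k :: nat where k: "k \<noteq> 0" "(a \<otimes> b) divides (c [^] k)" using c(2) by blast
    have "b divides ((a \<otimes> b) [^] (1::nat))"
      using a_carrier b by (simp add: divides_mult_right)
    then have "c divides ((a \<otimes> b) [^] (1 * l))"
      using l(2) a_carrier b c_carrier by (intro divides_nat_pow_trans[of c b]) auto
    then show "a \<otimes> b \<in> arch_rel G `` {c}"
      using k l(1) a_carrier b c_carrier by (auto simp: arch_rel_def)
  qed
qed

theorem theorem4:
  fixes H :: "('a, 'b) monoid_scheme" and S :: "'a set"
  assumes "comm_monoid_cancel H"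
    and "fin_gen_monoid H"
    and "divisor_closed_submonoid S H"
  shows "(\<exists>\<C> \<subseteq> arch_components H. S = \<Union>\<C>) \<and>
    (\<exists>S_hat \<in> arch_components H. S = \<Union>{S' \<in> arch_components H. arch_le H S' S_hat})"
proof -
  interpret comm_monoid_cancel H by fact
  have S_carrier: "S \<subseteq> carrier H"
    using assms(3) submonoid.subset by (auto simp: divisor_closed_submonoid_def)
  have union: "S = \<Union>{C \<in> arch_components H. C \<subseteq> S}"
  proof
    show "S \<subseteq> \<Union>{C \<in> arch_components H. C \<subseteq> S}"
    proof
      fix a assume "a \<in> S"
      then obtain C where "C \<in> arch_components H" "a \<in> C"
        using S_carrier Union_arch_components by blast
      then show "a \<in> \<Union>{C \<in> arch_components H. C \<subseteq> S}"
        using divisor_closed_component_subset[OF assms(3)] \<open>a \<in> S\<close> by blast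
    qed
  qed blast
  obtain c where c: "c \<in> S" "\<forall>s\<in>S. \<exists>k::nat. k \<noteq> 0 \<and> s divides\<^bsub>H\<^esub> (c [^]\<^bsub>H\<^esub> k)"
    using divisor_closed_has_dominating_element[OF assms(2,3)] by blast
  have "arch_rel H `` {c} \<in> arch_components H"
    using c(1) S_carrier by (auto simp: arch_components_def intro: quotientI)
  moreover have "{C \<in> arch_components H. arch_le H C (arch_rel H `` {c})}
      = {C \<in> arch_components H. C \<subseteq> S}"
    using arch_le_component_iff[OF assms(3) c] by blast
  ultimately have "\<exists>S_hat \<in> arch_components H. S = \<Union>{S' \<in> arch_components H. arch_le H S' S_hat}"
    using union by metis
  moreover have "\<exists>\<C> \<subseteq> arch_components H. S = \<Union>\<C>"
    using union by (metis (no_types, lifting) mem_Collect_eq subsetI)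
  ultimately show ?thesis by blast
qed

end
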